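(* Let $\rho$ be a probability distribution on $\mathcal S$ and $f_\rho(\pi)=\mathbb E_{s\sim\rho}[V^\pi_r(s)]$. Suppose that for every $\pi\in\mathrm{ReInt}(\Pi)$ (the relative interior of $\Pi$) the worst-case uncertainty is unique, i.e. for every $(s,a)$ the set $\operatorname{Argmax}_{u(\cdot|s,a)\in\mathcal U_{s,a}}\sum_{s'}\mathbb P_u(s'|s,a)V^\pi_r(s')$ is a singleton, and denote by $u_\pi$ the corresponding element of $\mathcal U$. Then $f_\rho$ is differentiable (in the sense of the context) everywhere in $\mathrm{ReInt}(\Pi)$, and its policy gradient is given by $$\nabla f_\rho(\pi)[s,a]=\frac{1}{1-\gamma}\,d_\rho^{\pi,u_\pi}(s)\,Q^\pi_{u_\pi}(s,a),\qquad\forall(s,a)\in\mathcal S\times\mathcal A .$$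
   Context: Robust MDP. $\mathcal S,\mathcal A$ are finite nonempty state and action sets, $c:\mathcal S\times\mathcal A\to\mathbb R$ is a cost with $0<c(s,a)\le1$, $\gamma\in(0,1)$ is the discount factor, and $\mathbb P_{N}$ is a nominal transition kernel ($\mathbb P_N(\cdot|s,a)\in\Delta_{\mathcal S}$, the probability simplex). The uncertainty set $\mathcal U\subset\mathbb R^{|\mathcal S|\times|\mathcal S|\times|\mathcal A|}$ is nonempty, compact and $(s,a)$-rectangular: $\mathcal U=\prod_{s,a}\mathcal U_{s,a}$ with $\mathcal U_{s,a}=\{u(\cdot|s,a):u\in\mathcal U\}$; for every $u\in\mathcal U$, $\mathbb P_u(\cdot|s,a)=\mathbb P_N(\cdot|s,a)+u(\cdot|s,a)$ is a transition kernel. $\Pi\subset\mathbb R^{|\mathcal S||\mathcal A|}$ is the set of stationary randomized policies ($\pi(\cdot|s)\in\Delta_{\mathcal A}$ for all $s$). $V^\pi_u(s)=\mathbb E[\sum_{t\ge0}\gamma^t c(s_t,a_t)\mid s_0=s]$ with $a_t\sim\pi(\cdot|s_t)$, $s_{t+1}\sim\mathbb P_u(\cdot|s_t,a_t)$; $Q^\pi_u(s,a)$ is the same with in addition $a_0=a$; $V^\pi_r(s)=\max_{u\in\mathcal U}V^\pi_u(s)$. $d^{\pi,u}_s(s')=(1-\gamma)\sum_{t\ge0}\gamma^t\Pr(s_t=s'\mid s_0=s)$ under policy $\pi$ and kernel $\mathbb P_u$; $d^{\pi,u}_\rho(s')=\mathbb E_{s\sim\rho}d^{\pi,u}_s(s')$.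 Differentiability (direct parameterization). A function $f:\Pi\to\mathbb R$ is differentiable at $\pi\in\Pi$ with policy gradient $\nabla f(\pi)\in\mathbb R^{|\mathcal S||\mathcal A|}$ if $$\lim_{\delta\to0,\ \pi+\delta\in\Pi}\ \frac{|f(\pi+\delta)-f(\pi)-\langle\nabla f(\pi),\delta\rangle|}{\|\delta\|_2}=0 ;$$ "the policy gradient is given by $g$" means that $\nabla f(\pi)=g$ satisfies this condition. *)

theory Defs
  imports "HOL-Probability.Probability"
begin

subsection \<open>Policies, kernels, policy gradients\<close>

text \<open>
  Policies are vectors \<open>\<pi> $ s $ a\<close>, transition kernels and uncertainties are vectors
  \<open>P $ s $ a $ s'\<close>. The norm and inner product of these nested vector types are the Euclidean ones
  of \<open>\<real>\<^bsup>|S||A|\<^esup>\<close> and \<open>\<real>\<^bsup>|S||S||A|\<^esup>\<close>.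
\<close>

definition prob_simplex :: "(real ^ 'n) set" where
  "prob_simplex = {x. (\<forall>i. 0 \<le> x $ i) \<and> (\<Sum>i\<in>UNIV. x $ i) = 1}"

definition policies :: "(real ^ 'a ^ 's) set" where
  "policies = {\<pi>. \<forall>s. \<pi> $ s \<in> prob_simplex}"

definition kernels :: "(real ^ 's ^ 'a ^ 's) set" where
  "kernels = {P. \<forall>s a. P $ s $ a \<in> prob_simplex}"

definition has_policy_gradient ::
    "(real ^ 'a ^ 's \<Rightarrow> real) \<Rightarrow> real ^ 'a ^ 's \<Rightarrow> real ^ 'a ^ 's \<Rightarrow> bool" where
  "has_policy_gradient f g \<pi> \<longleftrightarrow>
     ((\<lambda>\<delta>. \<bar>f (\<pi> + \<delta>) - f \<pi> - g \<bullet> \<delta>\<bar> / norm \<delta>) \<longlongrightarrow> 0) (at 0 within {\<delta>. \<pi> + \<delta> \<in> policies})"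

subsection \<open>The controlled Markov chain\<close>

text \<open>For a vector outside the simplex this is an unspecified probability mass function.\<close>

definition vec_pmf :: "real ^ 'n \<Rightarrow> 'n pmf" where
  "vec_pmf x = embed_pmf (\<lambda>i. x $ i)"

definition sa_step ::
    "real ^ 's ^ 'a ^ 's \<Rightarrow> real ^ 'a ^ 's \<Rightarrow> 's \<times> 'a \<Rightarrow> ('s \<times> 'a) pmf" where
  "sa_step P \<pi> = (\<lambda>(s, a). vec_pmf (P $ s $ a) \<bind> (\<lambda>s'. map_pmf (Pair s') (vec_pmf (\<pi> $ s'))))"

definition sa_kernel ::
    "('s \<times> 'a) pmf \<Rightarrow> real ^ 's ^ 'a ^ 's \<Rightarrow> real ^ 'a ^ 's
      \<Rightarrow> nat \<Rightarrow> (nat \<Rightarrow> 's \<times> 'a) \<Rightarrow> ('s \<times> 'a) measure" where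
  "sa_kernel \<mu> P \<pi> t \<omega> =
     measure_pmf (case t of 0 \<Rightarrow> \<mu> | Suc t' \<Rightarrow> sa_step P \<pi> (\<omega> t'))"

lemma Ionescu_Tulcea_sa_kernel:
  fixes P :: "real ^ 's ^ 'a ^ 's"
  shows "Ionescu_Tulcea (sa_kernel \<mu> P \<pi>) (\<lambda>_. count_space UNIV)"
proof
  fix t
  show "sa_kernel \<mu> P \<pi> t \<in>
      PiM {0..<t} (\<lambda>_. count_space UNIV) \<rightarrow>\<^sub>M subprob_algebra (count_space UNIV)"
  proof (cases t)
    case 0
    then show ?thesis
      by (auto simp: sa_kernel_def[abs_def] space_subprob_algebra intro!: measure_pmf.subprob_space_axioms)
  next
    case (Suc t')
    have "(\<lambda>\<omega>. \<omega> t') \<in>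
        PiM {0..<t} (\<lambda>_. count_space UNIV) \<rightarrow>\<^sub>M (count_space UNIV :: ('s \<times> 'a) measure)"
      using Suc by (intro measurable_component_singleton) auto
    moreover have "(\<lambda>x. measure_pmf (sa_step P \<pi> x)) \<in>
        count_space UNIV \<rightarrow>\<^sub>M subprob_algebra (count_space UNIV)"
      by (auto simp: space_subprob_algebra intro!: measure_pmf.subprob_space_axioms)
    ultimately show ?thesis
      using Suc by (auto simp: sa_kernel_def[abs_def] dest: measurable_compose)
  qed
qed (auto simp: sa_kernel_def intro: measure_pmf.prob_space_axioms)

text \<open>
  The law of \<open>(s\<^sub>0, a\<^sub>0), (s\<^sub>1, a\<^sub>1), \<dots>\<close> with \<open>(s\<^sub>0, a\<^sub>0) \<sim> \<mu>\<close>,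
  \<open>s\<^bsub>t+1\<^esub> \<sim> P(\<cdot> | s\<^sub>t, a\<^sub>t)\<close> and \<open>a\<^bsub>t+1\<^esub> \<sim> \<pi>(\<cdot> | s\<^bsub>t+1\<^esub>)\<close>, a measure on infinite
  state-action sequences given by the Ionescu-Tulcea theorem. Inside the library locale this
  measure is \<open>PF.lim\<close>, and \<open>Ionescu_Tulcea_sa_kernel\<close> discharges the locale assumptions.
\<close>

definition trajectory ::
    "('s \<times> 'a) pmf \<Rightarrow> real ^ 's ^ 'a ^ 's \<Rightarrow> real ^ 'a ^ 's \<Rightarrow> (nat \<Rightarrow> 's \<times> 'a) measure" where
  "trajectory \<mu> P \<pi> =
     projective_family.lim UNIV
       (Ionescu_Tulcea.CI (sa_kernel \<mu> P \<pi>) (\<lambda>_. count_space UNIV)) (\<lambda>_. count_space UNIV)"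

definition trajectory_from ::
    "'s \<Rightarrow> real ^ 's ^ 'a ^ 's \<Rightarrow> real ^ 'a ^ 's \<Rightarrow> (nat \<Rightarrow> 's \<times> 'a) measure" where
  "trajectory_from s P \<pi> = trajectory (map_pmf (Pair s) (vec_pmf (\<pi> $ s))) P \<pi>"

subsection \<open>Values and occupancy measures\<close>

definition discounted_cost :: "('s \<Rightarrow> 'a \<Rightarrow> real) \<Rightarrow> real \<Rightarrow> (nat \<Rightarrow> 's \<times> 'a) \<Rightarrow> real" where
  "discounted_cost c \<gamma> \<omega> = (\<Sum>t. \<gamma> ^ t * c (fst (\<omega> t)) (snd (\<omega> t)))"

definition value_fn ::
    "('s \<Rightarrow> 'a \<Rightarrow> real) \<Rightarrow> real \<Rightarrow> real ^ 's ^ 'a ^ 's \<Rightarrow> real ^ 'a ^ 's \<Rightarrow> 's \<Rightarrow> real" where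
  "value_fn c \<gamma> P \<pi> s = (\<integral>\<omega>. discounted_cost c \<gamma> \<omega> \<partial>trajectory_from s P \<pi>)"

definition q_fn ::
    "('s \<Rightarrow> 'a \<Rightarrow> real) \<Rightarrow> real \<Rightarrow> real ^ 's ^ 'a ^ 's \<Rightarrow> real ^ 'a ^ 's \<Rightarrow> 's \<Rightarrow> 'a \<Rightarrow> real" where
  "q_fn c \<gamma> P \<pi> s a =
     (\<integral>\<omega>. discounted_cost c \<gamma> \<omega> \<partial>trajectory (return_pmf (s, a)) P \<pi>)"

definition occupancy_from ::
    "real \<Rightarrow> real ^ 's ^ 'a ^ 's \<Rightarrow> real ^ 'a ^ 's \<Rightarrow> 's \<Rightarrow> 's \<Rightarrow> real" where
  "occupancy_from \<gamma> P \<pi> s s' =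
     (1 - \<gamma>) * (\<Sum>t. \<gamma> ^ t * \<P>(\<omega> in trajectory_from s P \<pi>. fst (\<omega> t) = s'))"

definition occupancy ::
    "real \<Rightarrow> real ^ 's ^ 'a ^ 's \<Rightarrow> real ^ 'a ^ 's \<Rightarrow> 's pmf \<Rightarrow> 's \<Rightarrow> real" where
  "occupancy \<gamma> P \<pi> \<rho> s' = measure_pmf.expectation \<rho> (\<lambda>s. occupancy_from \<gamma> P \<pi> s s')"

subsection \<open>Uncertainty\<close>

definition local_uncertainty ::
    "(real ^ 's ^ 'a ^ 's) set \<Rightarrow> 's \<Rightarrow> 'a \<Rightarrow> (real ^ 's) set" where
  "local_uncertainty U s a = (\<lambda>u. u $ s $ a) ` U"

definition sa_rectangular :: "(real ^ 's ^ 'a ^ 's) set \<Rightarrow> bool" where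
  "sa_rectangular U \<longleftrightarrow> U = {u. \<forall>s a. u $ s $ a \<in> local_uncertainty U s a}"

text \<open>
  The robust value is a maximum: for nonempty compact \<open>U\<close> the supremum is attained, as the value
  depends continuously on the kernel.
\<close>

definition robust_value ::
    "('s \<Rightarrow> 'a \<Rightarrow> real) \<Rightarrow> real \<Rightarrow> real ^ 's ^ 'a ^ 's \<Rightarrow> (real ^ 's ^ 'a ^ 's) set
      \<Rightarrow> real ^ 'a ^ 's \<Rightarrow> 's \<Rightarrow> real" where
  "robust_value c \<gamma> P\<^sub>N U \<pi> s = (SUP u\<in>U. value_fn c \<gamma> (P\<^sub>N + u) \<pi> s)"

definition worst_case_set ::
    "('s \<Rightarrow> 'a \<Rightarrow> real) \<Rightarrow> real \<Rightarrow> real ^ 's ^ 'a ^ 's \<Rightarrow> (real ^ 's ^ 'a ^ 's) set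
      \<Rightarrow> real ^ 'a ^ 's \<Rightarrow> 's \<Rightarrow> 'a \<Rightarrow> (real ^ 's) set" where
  "worst_case_set c \<gamma> P\<^sub>N U \<pi> s a =
     {w. is_arg_max (\<lambda>w. \<Sum>s'\<in>UNIV. (P\<^sub>N $ s $ a + w) $ s' * robust_value c \<gamma> P\<^sub>N U \<pi> s')
           (\<lambda>w. w \<in> local_uncertainty U s a) w}"

text \<open>Meaningful only when all the worst-case sets for \<open>\<pi>\<close> are singletons.\<close>

definition worst_case ::
    "('s \<Rightarrow> 'a \<Rightarrow> real) \<Rightarrow> real \<Rightarrow> real ^ 's ^ 'a ^ 's \<Rightarrow> (real ^ 's ^ 'a ^ 's) set
      \<Rightarrow> real ^ 'a ^ 's \<Rightarrow> real ^ 's ^ 'a ^ 's" where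
  "worst_case c \<gamma> P\<^sub>N U \<pi> = (\<chi> s. \<chi> a. the_elem (worst_case_set c \<gamma> P\<^sub>N U \<pi> s a))"

end

theory Submission
  imports Defs
begin

text \<open>
  For a fixed kernel \<open>P\<close> the performance difference lemma says that the expected values of two policies
  differ by \<open>\<langle>G P \<pi>', \<pi>' - \<pi>\<rangle>\<close>, where \<open>G P \<pi>'\<close> combines the occupancy measure of \<open>\<pi>'\<close> with the
  Q-function of \<open>\<pi>\<close> and depends continuously on \<open>(P, \<pi>')\<close>. As in Danskin's theorem, comparing the
  robust values at \<open>\<pi>\<close> and \<open>\<pi>'\<close> through the kernel that is worst for \<open>\<pi>\<close> gives a lower bound, and
  through the one that is worst for \<open>\<pi>'\<close> an upper bound, of \<open>f \<pi>' - f \<pi>\<close> by such inner products.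
  By compactness and uniqueness the worst kernel for \<open>\<pi>'\<close> tends to the one for \<open>\<pi>\<close>, so both bounds have
  the same linear part. In the relative interior every action has positive probability; this makes a
  kernel that attains the robust value maximal at every state-action pair, hence unique.
\<close>

subsection \<open>Marginals of the trajectory measure\<close>

text \<open>The time-\<open>t\<close> marginal of the chain as a pmf, built by a recursion on
  \<open>t\<close>, so that later computations use finite sums instead of the path measure.\<close>

primrec sa_law ::
    "('s \<times> 'a) pmf \<Rightarrow> real ^ 's ^ 'a ^ 's \<Rightarrow> real ^ 'a ^ 's \<Rightarrow> nat \<Rightarrow> ('s \<times> 'a) pmf" where
  "sa_law \<mu> P \<pi> 0 = \<mu>"
| "sa_law \<mu> P \<pi> (Suc t) = sa_law \<mu> P \<pi> t \<bind> sa_step P \<pi>"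

lemma sets_trajectory [measurable_cong]:
  "sets (trajectory \<mu> P \<pi>) = sets (PiM UNIV (\<lambda>_. count_space UNIV))"
proof -
  interpret IT: Ionescu_Tulcea "sa_kernel \<mu> P \<pi>" "\<lambda>_. count_space UNIV"
    by (rule Ionescu_Tulcea_sa_kernel)
  show ?thesis
    unfolding trajectory_def by simp
qed

lemma space_trajectory [simp]: "space (trajectory \<mu> P \<pi>) = UNIV"
  using sets_eq_imp_space_eq[OF sets_trajectory] by (simp add: space_PiM PiE_UNIV_domain)

lemma measurable_coordinate [measurable]: "(\<lambda>\<omega>. \<omega> t) \<in> trajectory \<mu> P \<pi> \<rightarrow>\<^sub>M count_space UNIV"
  by (simp add: measurable_cong_sets[OF sets_trajectory refl] measurable_component_singleton)

text \<open>Coordinate \<open>t\<close> is determined by the first \<open>Suc t\<close> coordinates,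
  so the projective limit reduces to the finite composition \<open>IT.C 0 (Suc t)\<close>, whose
  last kernel depends only on the preceding state-action pair.\<close>

lemma nn_integral_coordinate:
  fixes f :: "'s::finite \<times> 'a::finite \<Rightarrow> ennreal"
  shows "(\<integral>\<^sup>+\<omega>. f (\<omega> t) \<partial>trajectory \<mu> P \<pi>) = (\<integral>\<^sup>+x. f x \<partial>sa_law \<mu> P \<pi> t)"
proof -
  let ?M = "\<lambda>_::nat. count_space UNIV :: ('s \<times> 'a) measure"
  interpret IT: Ionescu_Tulcea "sa_kernel \<mu> P \<pi>" ?M
    by (rule Ionescu_Tulcea_sa_kernel)
  have meas: "(\<lambda>\<omega>. f (\<omega> t)) \<in> borel_measurable (PiM {0..<Suc t} ?M)" for f :: "'s \<times> 'a \<Rightarrow> ennreal" and t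
    by (rule measurable_compose[OF measurable_component_singleton]) auto
  \<comment> \<open>All \<open>f\<close> are treated at once, because the induction step applies the
    hypothesis to the one-step average of \<open>f\<close>.\<close>
  have C: "(\<integral>\<^sup>+\<omega>. f (\<omega> t) \<partial>IT.C 0 (Suc t) (\<lambda>_. undefined)) = (\<integral>\<^sup>+x. f x \<partial>sa_law \<mu> P \<pi> t)" for f
  proof (induction t arbitrary: f)
    case 0
    \<comment> \<open>The empty history: over no coordinates, the product space has the
      everywhere-undefined function as its only point.\<close>
    have u: "(\<lambda>_. undefined) \<in> space (PiM {0..<0} ?M)"
      by (simp add: space_PiM)
    have "IT.C 0 (Suc 0) (\<lambda>_. undefined) = IT.eP 0 (\<lambda>_. undefined)"
      unfolding IT.C.simps add_0 by (rule bind_return[OF IT.measurable_eP u])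
    then show ?case
      by (simp add: IT.nn_integral_eP[OF u meas] del: IT.C.simps) (simp add: sa_kernel_def)
  next
    case (Suc t)
    have u: "(\<lambda>_. undefined) \<in> space (PiM {0..<0} ?M)"
      by (simp add: space_PiM)
    have "(\<integral>\<^sup>+\<omega>. f (\<omega> (Suc t)) \<partial>IT.C 0 (Suc (Suc t)) (\<lambda>_. undefined)) =
        (\<integral>\<^sup>+\<omega>. (\<integral>\<^sup>+\<omega>'. f (\<omega>' (Suc t)) \<partial>IT.eP (Suc t) \<omega>) \<partial>IT.C 0 (Suc t) (\<lambda>_. undefined))"
      by (subst IT.C.simps(2))
        (simp add: nn_integral_bind[OF meas] measurable_cong_sets[OF IT.sets_C[OF u] refl] del: IT.C.simps)
    also have "\<dots> = (\<integral>\<^sup>+\<omega>. (\<integral>\<^sup>+x. f x \<partial>sa_step P \<pi> (\<omega> t)) \<partial>IT.C 0 (Suc t) (\<lambda>_. undefined))"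
      by (intro nn_integral_cong)
        (simp add: IT.space_C[OF u] IT.nn_integral_eP[OF _ meas] sa_kernel_def del: IT.C.simps)
    finally show ?case
      using Suc.IH[of "\<lambda>x. \<integral>\<^sup>+y. f y \<partial>sa_step P \<pi> x"] by simp
  qed
  \<comment> \<open>\<open>IT.up_to\<close> gives the least bound above an index set. It must be
    exactly \<open>Suc t\<close> here, so that the limit is matched with the composition over times
    \<open>0\<close> to \<open>t\<close>.\<close>
  have up: "IT.up_to {0..<Suc t} = Suc t"
    using IT.up_to_iff_Ico[of "{0..<Suc t}" "Suc t"] IT.up_to[of "{0..<Suc t}"] by auto
  have "(\<integral>\<^sup>+\<omega>. f (\<omega> t) \<partial>trajectory \<mu> P \<pi>) =
      (\<integral>\<^sup>+\<omega>. f (\<omega> t) \<partial>distr IT.PF.lim (PiM {0..<Suc t} ?M) (\<lambda>x. restrict x {0..<Suc t}))"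
    unfolding trajectory_def
    by (subst nn_integral_distr)
      (auto intro!: measurable_restrict measurable_component_singleton meas
         simp: measurable_cong_sets[OF IT.PF.sets_lim refl])
  also have "\<dots> = (\<integral>\<^sup>+\<omega>. f (\<omega> t) \<partial>IT.C 0 (Suc t) (\<lambda>_. undefined))"
    unfolding IT.distr_lim[OF finite_atLeastLessThan] IT.CI_def up
    by (subst nn_integral_distr)
      (auto intro!: measurable_restrict measurable_component_singleton meas
         simp: measurable_cong_sets[OF IT.sets_C refl] simp del: IT.C.simps)
  finally show ?thesis
    by (simp add: C del: IT.C.simps)
qed

lemma distr_coordinate:
  "distr (trajectory \<mu> P \<pi>) (count_space UNIV) (\<lambda>\<omega>. \<omega> t) = measure_pmf (sa_law \<mu> P \<pi> t)"
proof (rule measure_eqI)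
  fix A
  have "emeasure (distr (trajectory \<mu> P \<pi>) (count_space UNIV) (\<lambda>\<omega>. \<omega> t)) A =
      (\<integral>\<^sup>+x. indicator A x \<partial>distr (trajectory \<mu> P \<pi>) (count_space UNIV) (\<lambda>\<omega>. \<omega> t))"
    by simp
  also have "\<dots> = (\<integral>\<^sup>+\<omega>. indicator A (\<omega> t) \<partial>trajectory \<mu> P \<pi>)"
    by (rule nn_integral_distr[OF measurable_coordinate]) simp
  finally have "emeasure (distr (trajectory \<mu> P \<pi>) (count_space UNIV) (\<lambda>\<omega>. \<omega> t)) A =
      (\<integral>\<^sup>+\<omega>. indicator A (\<omega> t) \<partial>trajectory \<mu> P \<pi>)" .
  then show "emeasure (distr (trajectory \<mu> P \<pi>) (count_space UNIV) (\<lambda>\<omega>. \<omega> t)) A =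
      emeasure (measure_pmf (sa_law \<mu> P \<pi> t)) A"
    using nn_integral_coordinate[where f = "indicator A" and t = t and \<mu> = \<mu> and P = P and \<pi> = \<pi>] by simp
qed simp

text \<open>Total mass can be read off an image measure, and the time-0 marginal is a pmf.\<close>

lemma prob_space_trajectory: "prob_space (trajectory \<mu> P \<pi>)"
proof (rule prob_space_distrD[OF measurable_coordinate[of 0]])
  show "prob_space (distr (trajectory \<mu> P \<pi>) (count_space UNIV) (\<lambda>\<omega>. \<omega> 0))"
    unfolding distr_coordinate by (rule measure_pmf.prob_space_axioms)
qed

lemma expectation_coordinate:
  fixes f :: "'s::finite \<times> 'a::finite \<Rightarrow> real"
  shows "(\<integral>\<omega>. f (\<omega> t) \<partial>trajectory \<mu> P \<pi>) = measure_pmf.expectation (sa_law \<mu> P \<pi> t) f"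
  by (subst distr_coordinate[symmetric], subst integral_distr) auto

lemma integrable_coordinate:
  fixes f :: "'s::finite \<times> 'a::finite \<Rightarrow> real"
  shows "integrable (trajectory \<mu> P \<pi>) (\<lambda>\<omega>. f (\<omega> t))"
proof -
  interpret prob_space "trajectory \<mu> P \<pi>"
    by (rule prob_space_trajectory)
  have "(\<lambda>\<omega>. f (\<omega> t)) \<in> borel_measurable (trajectory \<mu> P \<pi>)"
    by (rule measurable_compose[OF measurable_coordinate]) auto
  then show ?thesis
    by (intro integrable_const_bound[where B = "Max (range (\<lambda>x. \<bar>f x\<bar>))"]) auto
qed

subsection \<open>The resolvent of the state-action chain\<close>

lemma pmf_vec_pmf:
  assumes "x \<in> prob_simplex"
  shows "pmf (vec_pmf x) i = x $ i"
proof -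
  have "(\<integral>\<^sup>+i. ennreal (x $ i) \<partial>count_space UNIV) = 1"
    using assms by (simp add: nn_integral_count_space_finite prob_simplex_def sum_nonneg)
  then show ?thesis
    using assms unfolding vec_pmf_def prob_simplex_def by (intro pmf_embed_pmf) auto
qed

text \<open>The Markov operator of the state-action chain acting on functions: conditional
  expectation one step ahead. It is written with vector entries instead of pmfs, so that its powers
  are visibly polynomial in \<open>P\<close> and \<pi>.\<close>

definition transition_op ::
    "real ^ 's ^ 'a ^ 's \<Rightarrow> real ^ 'a ^ 's \<Rightarrow> ('s \<times> 'a \<Rightarrow> real) \<Rightarrow> 's \<times> 'a \<Rightarrow> real" where
  "transition_op P \<pi> f = (\<lambda>(s, a). \<Sum>s'\<in>UNIV. P $ s $ a $ s' * (\<Sum>a'\<in>UNIV. \<pi> $ s' $ a' * f (s', a')))"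

lemma transition_op_Pair:
  "transition_op P \<pi> f (s, a) =
    (\<Sum>s'\<in>UNIV. P $ s $ a $ s' * (\<Sum>a'\<in>UNIV. \<pi> $ s' $ a' * f (s', a')))"
  by (simp add: transition_op_def)

text \<open>The Neumann series of (I - \<gamma> T)^(-1) for the Markov operator T. With
  \<open>f\<close> the cost it gives the Q-function; with \<open>f\<close> the indicator of a state
  it gives, after averaging over the first action and scaling, the occupancy measure.\<close>

definition resolvent ::
    "real \<Rightarrow> real ^ 's ^ 'a ^ 's \<Rightarrow> real ^ 'a ^ 's \<Rightarrow> ('s \<times> 'a \<Rightarrow> real) \<Rightarrow> 's \<times> 'a \<Rightarrow> real" where
  "resolvent \<gamma> P \<pi> f x = (\<Sum>t. \<gamma> ^ t * (transition_op P \<pi> ^^ t) f x)"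

lemma expectation_sum_UNIV:
  fixes f :: "'b::finite \<Rightarrow> real"
  shows "measure_pmf.expectation p f = (\<Sum>x\<in>UNIV. pmf p x * f x)"
  using integral_measure_pmf[of UNIV p f] by simp

lemma expectation_sa_step:
  fixes P :: "real ^ 's::finite ^ 'a::finite ^ 's"
  assumes "P \<in> kernels" "\<pi> \<in> policies"
  shows "measure_pmf.expectation (sa_step P \<pi> x) f = transition_op P \<pi> f x"
proof (cases x)
  case (Pair s a)
  have "measure_pmf.expectation (sa_step P \<pi> x) f =
      (\<Sum>s'\<in>UNIV. pmf (vec_pmf (P $ s $ a)) s' *
         measure_pmf.expectation (map_pmf (Pair s') (vec_pmf (\<pi> $ s'))) f)"
    unfolding sa_step_def Pair
    by (simp add: pmf_expectation_bind[where A = UNIV])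
  moreover have "measure_pmf.expectation (map_pmf (Pair s') (vec_pmf (\<pi> $ s'))) f =
      (\<Sum>a'\<in>UNIV. \<pi> $ s' $ a' * f (s', a'))" for s'
    using assms(2) unfolding integral_map_pmf unfolding expectation_sum_UNIV
    by (simp add: policies_def pmf_vec_pmf)
  ultimately show ?thesis
    using assms(1) by (simp add: Pair transition_op_def kernels_def pmf_vec_pmf)
qed

lemma expectation_sa_law:
  fixes P :: "real ^ 's::finite ^ 'a::finite ^ 's"
  assumes "P \<in> kernels" "\<pi> \<in> policies"
  shows "measure_pmf.expectation (sa_law \<mu> P \<pi> t) f =
    measure_pmf.expectation \<mu> ((transition_op P \<pi> ^^ t) f)"
proof (induction t arbitrary: f)
  case (Suc t)
  have "measure_pmf.expectation (sa_law \<mu> P \<pi> (Suc t)) f =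
      (\<Sum>x\<in>UNIV. pmf (sa_law \<mu> P \<pi> t) x * measure_pmf.expectation (sa_step P \<pi> x) f)"
    by (simp add: pmf_expectation_bind[where A = UNIV])
  also have "\<dots> = measure_pmf.expectation (sa_law \<mu> P \<pi> t) (transition_op P \<pi> f)"
    by (simp only: expectation_sum_UNIV[of "sa_law \<mu> P \<pi> t"] expectation_sa_step[OF assms])
  \<comment> \<open>The law grows at its last step, which puts the extra operator innermost; powers
    of one operator commute with it, so it may be moved to the outside.\<close>
  finally show ?case
    by (simp add: Suc.IH funpow_swap1)
qed simp

lemma simplex_average_le:
  assumes "x \<in> prob_simplex" "\<And>i. g i \<le> B"
  shows "(\<Sum>i\<in>UNIV. x $ i * g i) \<le> B"
proof -
  have "(\<Sum>i\<in>UNIV. x $ i * g i) \<le> (\<Sum>i\<in>UNIV. x $ i * B)"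
    using assms by (intro sum_mono mult_left_mono) (auto simp: prob_simplex_def)
  also have "\<dots> = B"
    using assms by (simp add: prob_simplex_def flip: sum_distrib_right)
  finally show ?thesis .
qed

lemma simplex_average_abs_le:
  assumes "x \<in> prob_simplex" "\<And>i. \<bar>g i\<bar> \<le> B"
  shows "\<bar>\<Sum>i\<in>UNIV. x $ i * g i\<bar> \<le> B"
  using simplex_average_le[of x g B] simplex_average_le[of x "\<lambda>i. - g i" B] assms
  by (auto simp: sum_negf abs_le_iff)

lemma transition_op_abs_le:
  assumes "P \<in> kernels" "\<pi> \<in> policies" "\<And>x. \<bar>f x\<bar> \<le> B"
  shows "\<bar>(transition_op P \<pi> ^^ t) f x\<bar> \<le> B"
proof (induction t arbitrary: x)
  case (Suc t)
  obtain s a where x: "x = (s, a)"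
    by fastforce
  show ?case
    unfolding x funpow.simps comp_apply transition_op_Pair
    using assms(1,2) Suc.IH
    by (intro simplex_average_abs_le) (auto simp: kernels_def policies_def)
qed (simp add: assms)

lemma ex_abs_bound:
  fixes f :: "'b::finite \<Rightarrow> real"
  obtains B where "0 \<le> B" "\<And>x. \<bar>f x\<bar> \<le> B"
proof
  show "\<bar>f x\<bar> \<le> (\<Sum>x\<in>UNIV. \<bar>f x\<bar>)" for x
    by (rule member_le_sum) auto
qed (simp add: sum_nonneg)

lemma summable_discounted:
  fixes a :: "nat \<Rightarrow> real"
  assumes "0 < \<gamma>" "\<gamma> < 1" "\<And>t. \<bar>a t\<bar> \<le> B"
  shows "summable (\<lambda>t. \<bar>\<gamma> ^ t * a t\<bar>)" "summable (\<lambda>t. \<gamma> ^ t * a t)"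
proof -
  have "summable (\<lambda>t. \<gamma> ^ t * B)"
    using assms by (intro summable_mult2 summable_geometric) auto
  then show "summable (\<lambda>t. \<bar>\<gamma> ^ t * a t\<bar>)"
    by (rule summable_comparison_test[rotated])
      (use assms in \<open>auto simp: abs_mult intro!: mult_left_mono\<close>)
  then show "summable (\<lambda>t. \<gamma> ^ t * a t)"
    by (rule summable_rabs_cancel)
qed

lemma summable_resolvent:
  fixes P :: "real ^ 's::finite ^ 'a::finite ^ 's"
  assumes "0 < \<gamma>" "\<gamma> < 1" "P \<in> kernels" "\<pi> \<in> policies"
  shows "summable (\<lambda>t. \<gamma> ^ t * (transition_op P \<pi> ^^ t) f x)"
  by (rule ex_abs_bound[of f])
    (rule summable_discounted(2)[OF assms(1,2) transition_op_abs_le[OF assms(3,4)]])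

text \<open>The terms are dominated by \<gamma>^t B, so expectation and series can be exchanged.
  Each time-\<open>t\<close> expectation is then a power of the Markov operator averaged over the
  initial law.\<close>

lemma expectation_discounted_sum:
  fixes P :: "real ^ 's::finite ^ 'a::finite ^ 's"
  assumes "0 < \<gamma>" "\<gamma> < 1" "P \<in> kernels" "\<pi> \<in> policies"
  shows "(\<integral>\<omega>. (\<Sum>t. \<gamma> ^ t * f (\<omega> t)) \<partial>trajectory \<mu> P \<pi>) =
    measure_pmf.expectation \<mu> (resolvent \<gamma> P \<pi> f)"
proof -
  interpret prob_space "trajectory \<mu> P \<pi>"
    by (rule prob_space_trajectory)
  obtain B where B: "0 \<le> B" "\<And>x. \<bar>f x\<bar> \<le> B"
    by (rule ex_abs_bound[of f]) blast
  have "(\<integral>\<omega>. (\<Sum>t. \<gamma> ^ t * f (\<omega> t)) \<partial>trajectory \<mu> P \<pi>) =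
      (\<Sum>t. \<integral>\<omega>. \<gamma> ^ t * f (\<omega> t) \<partial>trajectory \<mu> P \<pi>)"
  proof (rule integral_suminf)
    show "integrable (trajectory \<mu> P \<pi>) (\<lambda>\<omega>. \<gamma> ^ t * f (\<omega> t))" for t
      by (intro integrable_mult_right integrable_coordinate)
    show "AE \<omega> in trajectory \<mu> P \<pi>. summable (\<lambda>t. norm (\<gamma> ^ t * f (\<omega> t)))"
      using summable_discounted(1)[OF assms(1,2) B(2)] by simp
    have int: "(\<integral>\<omega>. norm (\<gamma> ^ t * f (\<omega> t)) \<partial>trajectory \<mu> P \<pi>) =
        \<gamma> ^ t * (\<integral>\<omega>. \<bar>f (\<omega> t)\<bar> \<partial>trajectory \<mu> P \<pi>)" for t
      using assms(1) by (simp add: abs_mult)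
    have "\<bar>\<integral>\<omega>. \<bar>f (\<omega> t)\<bar> \<partial>trajectory \<mu> P \<pi>\<bar> \<le> B" for t
      using integral_le_const[of "\<lambda>\<omega>. \<bar>f (\<omega> t)\<bar>" B] B
        integrable_coordinate[of \<mu> P \<pi> "\<lambda>x. \<bar>f x\<bar>" t]
      by simp
    then show "summable (\<lambda>t. \<integral>\<omega>. norm (\<gamma> ^ t * f (\<omega> t)) \<partial>trajectory \<mu> P \<pi>)"
      unfolding int by (rule summable_discounted(2)[OF assms(1,2)])
  qed
  also have "\<dots> = (\<Sum>t. \<Sum>x\<in>UNIV. pmf \<mu> x * (\<gamma> ^ t * (transition_op P \<pi> ^^ t) f x))"
    by (simp add: expectation_coordinate expectation_sa_law[OF assms(3,4)] expectation_sum_UNIV[of \<mu>]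
        sum_distrib_left mult_ac)
  also have "\<dots> = (\<Sum>x\<in>UNIV. \<Sum>t. pmf \<mu> x * (\<gamma> ^ t * (transition_op P \<pi> ^^ t) f x))"
    by (intro suminf_sum summable_mult summable_resolvent assms)
  also have "\<dots> = measure_pmf.expectation \<mu> (resolvent \<gamma> P \<pi> f)"
    by (simp add: expectation_sum_UNIV resolvent_def suminf_mult summable_resolvent[OF assms])
  finally show ?thesis .
qed

text \<open>Splitting off the term for time 0 leaves a factor \<gamma> and one application of the
  Markov operator, which is a finite sum and so commutes with the convergent series.\<close>

lemma resolvent_unfold:
  fixes P :: "real ^ 's::finite ^ 'a::finite ^ 's"
  assumes "0 < \<gamma>" "\<gamma> < 1" "P \<in> kernels" "\<pi> \<in> policies"
  shows "resolvent \<gamma> P \<pi> f x = f x + \<gamma> * transition_op P \<pi> (resolvent \<gamma> P \<pi> f) x"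
proof -
  obtain s a where x: "x = (s, a)"
    by fastforce
  let ?r = "\<lambda>t x. \<gamma> ^ t * (transition_op P \<pi> ^^ t) f x"
  note summ = summable_resolvent[OF assms]
  have "(\<Sum>t. ?r t x) = ?r 0 x + (\<Sum>t. ?r (Suc t) x)"
    using suminf_split_head[OF summ[of f x]] by simp
  also have "(\<Sum>t. ?r (Suc t) x) =
      (\<Sum>t. \<gamma> * (\<Sum>s'\<in>UNIV. P $ s $ a $ s' * (\<Sum>a'\<in>UNIV. \<pi> $ s' $ a' * ?r t (s', a'))))"
    by (simp add: x transition_op_Pair sum_distrib_left mult_ac)
  also have "\<dots> = \<gamma> * (\<Sum>t. \<Sum>s'\<in>UNIV. P $ s $ a $ s' * (\<Sum>a'\<in>UNIV. \<pi> $ s' $ a' * ?r t (s', a')))"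
    by (intro suminf_mult summable_sum summable_mult summ)
  also have "(\<Sum>t. \<Sum>s'\<in>UNIV. P $ s $ a $ s' * (\<Sum>a'\<in>UNIV. \<pi> $ s' $ a' * ?r t (s', a'))) =
      (\<Sum>s'\<in>UNIV. \<Sum>t. P $ s $ a $ s' * (\<Sum>a'\<in>UNIV. \<pi> $ s' $ a' * ?r t (s', a')))"
    by (intro suminf_sum summable_sum summable_mult summ)
  also have "\<dots> = (\<Sum>s'\<in>UNIV. P $ s $ a $ s' * (\<Sum>t. \<Sum>a'\<in>UNIV. \<pi> $ s' $ a' * ?r t (s', a')))"
    by (intro sum.cong refl suminf_mult summable_sum summable_mult summ)
  also have "\<dots> = (\<Sum>s'\<in>UNIV. P $ s $ a $ s' * (\<Sum>a'\<in>UNIV. \<Sum>t. \<pi> $ s' $ a' * ?r t (s', a')))"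
    by (intro sum.cong refl arg_cong2[where f = "(*)"] suminf_sum summable_mult summ)
  also have "\<dots> = transition_op P \<pi> (resolvent \<gamma> P \<pi> f) x"
    by (simp add: x transition_op_Pair resolvent_def suminf_mult summ)
  finally show ?thesis
    by (simp add: resolvent_def)
qed

lemma continuous_on_transition_op_funpow:
  fixes P :: "'b::topological_space \<Rightarrow> real ^ 's::finite ^ 'a::finite ^ 's"
  assumes "continuous_on X P" "continuous_on X \<pi>"
  shows "continuous_on X (\<lambda>z. (transition_op (P z) (\<pi> z) ^^ t) f x)"
proof (induction t arbitrary: x)
  case (Suc t)
  obtain s a where x: "x = (s, a)"
    by fastforce
  show ?case
    unfolding x funpow.simps comp_apply transition_op_Pair
    by (intro continuous_intros Suc.IH assms)
qed simp

text \<open>Partial sums are polynomial in the entries of kernel and policy, and the M-test bound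
  \<gamma>^t B is uniform over all stochastic kernels and policies.\<close>

lemma continuous_on_resolvent:
  fixes P :: "'b::topological_space \<Rightarrow> real ^ 's::finite ^ 'a::finite ^ 's"
  assumes "0 < \<gamma>" "\<gamma> < 1"
    and "continuous_on X P" "\<And>z. z \<in> X \<Longrightarrow> P z \<in> kernels"
    and "continuous_on X \<pi>" "\<And>z. z \<in> X \<Longrightarrow> \<pi> z \<in> policies"
  shows "continuous_on X (\<lambda>z. resolvent \<gamma> (P z) (\<pi> z) f x)"
proof -
  obtain B where B: "0 \<le> B" "\<And>x. \<bar>f x\<bar> \<le> B"
    by (rule ex_abs_bound[of f]) blast
  have "uniform_limit X (\<lambda>n z. \<Sum>t<n. \<gamma> ^ t * (transition_op (P z) (\<pi> z) ^^ t) f x)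
      (\<lambda>z. resolvent \<gamma> (P z) (\<pi> z) f x) sequentially"
    unfolding resolvent_def
  proof (rule Weierstrass_m_test)
    show "summable (\<lambda>t. \<gamma> ^ t * B)"
      using assms by (intro summable_mult2 summable_geometric) auto
  qed (use assms B in \<open>auto simp: abs_mult intro!: mult_left_mono transition_op_abs_le\<close>)
  then show ?thesis
    by (rule uniform_limit_theorem[rotated])
      (auto intro!: always_eventually continuous_intros continuous_on_transition_op_funpow assms)
qed

subsection \<open>Bellman equations\<close>

lemma trajectory_from_expectation:
  fixes P :: "real ^ 's::finite ^ 'a::finite ^ 's"
  assumes "0 < \<gamma>" "\<gamma> < 1" "P \<in> kernels" "\<pi> \<in> policies"
  shows "(\<integral>\<omega>. (\<Sum>t. \<gamma> ^ t * f (\<omega> t)) \<partial>trajectory_from s P \<pi>) =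
    (\<Sum>a\<in>UNIV. \<pi> $ s $ a * resolvent \<gamma> P \<pi> f (s, a))"
  unfolding trajectory_from_def expectation_discounted_sum[OF assms] integral_map_pmf
  unfolding expectation_sum_UNIV
  using assms by (simp add: policies_def pmf_vec_pmf)

lemma q_fn_eq_resolvent:
  fixes P :: "real ^ 's::finite ^ 'a::finite ^ 's"
  assumes "0 < \<gamma>" "\<gamma> < 1" "P \<in> kernels" "\<pi> \<in> policies"
  shows "q_fn c \<gamma> P \<pi> s a = resolvent \<gamma> P \<pi> (\<lambda>x. c (fst x) (snd x)) (s, a)"
  unfolding q_fn_def discounted_cost_def
  using expectation_discounted_sum[OF assms, where f = "\<lambda>x. c (fst x) (snd x)" and \<mu> = "return_pmf (s, a)"]
  by simp

lemma value_fn_eq_sum_q_fn: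
  fixes P :: "real ^ 's::finite ^ 'a::finite ^ 's"
  assumes "0 < \<gamma>" "\<gamma> < 1" "P \<in> kernels" "\<pi> \<in> policies"
  shows "value_fn c \<gamma> P \<pi> s = (\<Sum>a\<in>UNIV. \<pi> $ s $ a * q_fn c \<gamma> P \<pi> s a)"
  unfolding value_fn_def discounted_cost_def
  using trajectory_from_expectation[OF assms, where f = "\<lambda>x. c (fst x) (snd x)"]
  by (simp add: q_fn_eq_resolvent[OF assms])

lemma q_fn_unfold:
  fixes P :: "real ^ 's::finite ^ 'a::finite ^ 's"
  assumes "0 < \<gamma>" "\<gamma> < 1" "P \<in> kernels" "\<pi> \<in> policies"
  shows "q_fn c \<gamma> P \<pi> s a = c s a + \<gamma> * (\<Sum>s'\<in>UNIV. P $ s $ a $ s' * value_fn c \<gamma> P \<pi> s')"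
  unfolding value_fn_eq_sum_q_fn[OF assms] q_fn_eq_resolvent[OF assms]
  by (subst resolvent_unfold[OF assms]) (simp add: transition_op_Pair)

text \<open>Policy evaluation with an arbitrary continuation value \<open>h\<close>. The kernel is a
  separate argument, since the robust argument compares different kernels on the same
  \<open>h\<close>.\<close>

definition bellman_op ::
    "('s \<Rightarrow> 'a \<Rightarrow> real) \<Rightarrow> real \<Rightarrow> real ^ 's ^ 'a ^ 's \<Rightarrow> real ^ 'a ^ 's \<Rightarrow> ('s \<Rightarrow> real) \<Rightarrow> 's \<Rightarrow> real" where
  "bellman_op c \<gamma> P \<pi> h s =
     (\<Sum>a\<in>UNIV. \<pi> $ s $ a * (c s a + \<gamma> * (\<Sum>s'\<in>UNIV. P $ s $ a $ s' * h s')))"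

lemma value_fn_bellman:
  fixes P :: "real ^ 's::finite ^ 'a::finite ^ 's"
  assumes "0 < \<gamma>" "\<gamma> < 1" "P \<in> kernels" "\<pi> \<in> policies"
  shows "bellman_op c \<gamma> P \<pi> (value_fn c \<gamma> P \<pi>) s = value_fn c \<gamma> P \<pi> s"
  unfolding value_fn_eq_sum_q_fn[OF assms, of c s] q_fn_unfold[OF assms] bellman_op_def ..

text \<open>A visit probability is the expectation of an indicator, so occupancy is a resolvent. The
  first form yields continuity; the second, a recursion in the starting state, serves to solve
  Poisson equations.\<close>

lemma occupancy_from_unfold:
  fixes P :: "real ^ 's::finite ^ 'a::finite ^ 's"
  assumes "0 < \<gamma>" "\<gamma> < 1" "P \<in> kernels" "\<pi> \<in> policies"
  defines "r \<equiv> \<lambda>s'. resolvent \<gamma> P \<pi> (\<lambda>x. of_bool (fst x = s'))"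
  shows "occupancy_from \<gamma> P \<pi> s s' = (1 - \<gamma>) * (\<Sum>a\<in>UNIV. \<pi> $ s $ a * r s' (s, a))"
    and "occupancy_from \<gamma> P \<pi> s s' = (1 - \<gamma>) * of_bool (s = s') +
      \<gamma> * (\<Sum>a\<in>UNIV. \<pi> $ s $ a * (\<Sum>s1\<in>UNIV. P $ s $ a $ s1 * occupancy_from \<gamma> P \<pi> s1 s'))"
proof -
  \<comment> \<open>Needed for every start, since the recursion also rewrites the occupancies of the
    successor states.\<close>
  have eq: "occupancy_from \<gamma> P \<pi> s s' = (1 - \<gamma>) * (\<Sum>a\<in>UNIV. \<pi> $ s $ a * r s' (s, a))" for s
  proof -
    interpret prob_space "trajectory_from s P \<pi>"
      unfolding trajectory_from_def by (rule prob_space_trajectory)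
    let ?f = "\<lambda>x::'s \<times> 'a. of_bool (fst x = s') :: real"
    let ?\<mu> = "map_pmf (Pair s) (vec_pmf (\<pi> $ s))"
    have "prob {\<omega> \<in> space (trajectory_from s P \<pi>). fst (\<omega> t) = s'} =
        measure_pmf.expectation ?\<mu> ((transition_op P \<pi> ^^ t) ?f)" for t
    proof -
      have "prob {\<omega> \<in> space (trajectory_from s P \<pi>). fst (\<omega> t) = s'} =
          expectation (indicator {\<omega>. fst (\<omega> t) = s'})"
        by (simp add: Collect_conj_eq Int_commute)
      also have "\<dots> = expectation (\<lambda>\<omega>. ?f (\<omega> t))"
        by (rule Bochner_Integration.integral_cong) (auto simp: indicator_def)
      finally have "prob {\<omega> \<in> space (trajectory_from s P \<pi>). fst (\<omega> t) = s'} =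
          expectation (\<lambda>\<omega>. ?f (\<omega> t))" .
      then show ?thesis
        unfolding trajectory_from_def expectation_sa_law[OF assms(3,4), symmetric]
        using expectation_coordinate[where f = ?f] by simp
    qed
    then have "occupancy_from \<gamma> P \<pi> s s' =
        (1 - \<gamma>) * (\<Sum>t. \<gamma> ^ t * measure_pmf.expectation ?\<mu> ((transition_op P \<pi> ^^ t) ?f))"
      unfolding occupancy_from_def by simp
    also have "(\<lambda>t. \<gamma> ^ t * measure_pmf.expectation ?\<mu> ((transition_op P \<pi> ^^ t) ?f)) =
        (\<lambda>t. \<Sum>a\<in>UNIV. \<pi> $ s $ a * (\<gamma> ^ t * (transition_op P \<pi> ^^ t) ?f (s, a)))"
      unfolding integral_map_pmf unfolding expectation_sum_UNIV
      using assms(4) by (simp add: policies_def pmf_vec_pmf sum_distrib_left mult_ac)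
    also have "(\<Sum>t. \<Sum>a\<in>UNIV. \<pi> $ s $ a * (\<gamma> ^ t * (transition_op P \<pi> ^^ t) ?f (s, a))) =
        (\<Sum>a\<in>UNIV. \<Sum>t. \<pi> $ s $ a * (\<gamma> ^ t * (transition_op P \<pi> ^^ t) ?f (s, a)))"
      by (intro suminf_sum summable_mult summable_resolvent assms)
    also have "\<dots> = (\<Sum>a\<in>UNIV. \<pi> $ s $ a * r s' (s, a))"
      by (simp add: r_def resolvent_def suminf_mult summable_resolvent[OF assms(1-4)])
    finally show ?thesis .
  qed
  then show "occupancy_from \<gamma> P \<pi> s s' = (1 - \<gamma>) * (\<Sum>a\<in>UNIV. \<pi> $ s $ a * r s' (s, a))" .
  have r: "r s' (s, a) = of_bool (s = s') +
      \<gamma> * (\<Sum>s1\<in>UNIV. P $ s $ a $ s1 * (\<Sum>a'\<in>UNIV. \<pi> $ s1 $ a' * r s' (s1, a')))" for a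
    unfolding r_def by (subst resolvent_unfold[OF assms(1-4)]) (simp add: transition_op_Pair)
  have "(\<Sum>a\<in>UNIV. \<pi> $ s $ a) = 1"
    using assms(4) by (simp add: policies_def prob_simplex_def)
  then show "occupancy_from \<gamma> P \<pi> s s' = (1 - \<gamma>) * of_bool (s = s') +
      \<gamma> * (\<Sum>a\<in>UNIV. \<pi> $ s $ a * (\<Sum>s1\<in>UNIV. P $ s $ a $ s1 * occupancy_from \<gamma> P \<pi> s1 s'))"
    unfolding eq
    by (subst r)
      (simp add: distrib_left sum.distrib sum_distrib_left[symmetric] sum_distrib_right[symmetric] mult.left_commute
        del: of_bool_eq_iff)
qed

text \<open>Maximum principle: at a state where \<open>z\<close> attains its maximum m, the averages
  on the right are at most m, so m \<le> \<gamma> m, which forces m \<le> 0 as \<gamma> < 1.\<close>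

lemma discounted_subharmonic_nonpos:
  fixes P :: "real ^ 's::finite ^ 'a::finite ^ 's"
  assumes "0 < \<gamma>" "\<gamma> < 1" "P \<in> kernels" "\<pi> \<in> policies"
    and sub: "\<And>s. z s \<le> \<gamma> * (\<Sum>a\<in>UNIV. \<pi> $ s $ a * (\<Sum>s'\<in>UNIV. P $ s $ a $ s' * z s'))"
  shows "z s \<le> 0"
proof -
  define m where "m = Max (range z)"
  have le: "z s \<le> m" for s
    unfolding m_def by (rule Max_ge) auto
  have "m \<in> range z"
    unfolding m_def by (rule Max_in) auto
  then obtain s0 where s0: "m = z s0"
    by auto
  have "(\<Sum>a\<in>UNIV. \<pi> $ s0 $ a * (\<Sum>s'\<in>UNIV. P $ s0 $ a $ s' * z s')) \<le> m"
    using assms(3,4) le by (intro simplex_average_le) (auto simp: kernels_def policies_def)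
  then have "m \<le> \<gamma> * m"
    using sub[of s0] assms(1) s0 by (smt (verit) mult_left_mono)
  then have "m \<le> 0"
    using assms(2) by (smt (verit) mult_le_cancel_right1)
  then show ?thesis
    using le[of s] by simp
qed

lemma bellman_op_diff:
  "bellman_op c \<gamma> P \<pi> h s - bellman_op c \<gamma> P \<pi> h' s =
    \<gamma> * (\<Sum>a\<in>UNIV. \<pi> $ s $ a * (\<Sum>s'\<in>UNIV. P $ s $ a $ s' * (h s' - h' s')))"
  unfolding bellman_op_def
  by (simp add: algebra_simps sum_distrib_left flip: sum_subtractf)

text \<open>Subtracting the fixed-point equation of the value function from the inequality for
  \<open>h\<close> cancels the costs and leaves a discounted subharmonic difference.
  \<open>value_fn_le\<close> is the mirror image.\<close>

lemma le_value_fn: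
  fixes P :: "real ^ 's::finite ^ 'a::finite ^ 's"
  assumes "0 < \<gamma>" "\<gamma> < 1" "P \<in> kernels" "\<pi> \<in> policies"
    and "\<And>s. h s \<le> bellman_op c \<gamma> P \<pi> h s"
  shows "h s \<le> value_fn c \<gamma> P \<pi> s"
proof -
  have "h s - value_fn c \<gamma> P \<pi> s \<le> 0"
    by (rule discounted_subharmonic_nonpos[OF assms(1-4)], subst bellman_op_diff[of c, symmetric])
      (use assms(5) value_fn_bellman[OF assms(1-4)] in auto)
  then show ?thesis
    by simp
qed

lemma value_fn_le:
  fixes P :: "real ^ 's::finite ^ 'a::finite ^ 's"
  assumes "0 < \<gamma>" "\<gamma> < 1" "P \<in> kernels" "\<pi> \<in> policies"
    and "\<And>s. bellman_op c \<gamma> P \<pi> h s \<le> h s"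
  shows "value_fn c \<gamma> P \<pi> s \<le> h s"
proof -
  have "value_fn c \<gamma> P \<pi> s - h s \<le> 0"
    by (rule discounted_subharmonic_nonpos[OF assms(1-4)], subst bellman_op_diff[of c, symmetric])
      (use assms(5) value_fn_bellman[OF assms(1-4)] in auto)
  then show ?thesis
    by simp
qed

text \<open>The occupancy recursion shows that the right-hand side solves the same linear equation
  as \<open>x\<close>, and the maximum principle makes the solution unique.\<close>

lemma discounted_poisson_solution:
  fixes P :: "real ^ 's::finite ^ 'a::finite ^ 's"
  assumes "0 < \<gamma>" "\<gamma> < 1" "P \<in> kernels" "\<pi> \<in> policies"
    and x: "\<And>s. x s = g s + \<gamma> * (\<Sum>a\<in>UNIV. \<pi> $ s $ a * (\<Sum>s'\<in>UNIV. P $ s $ a $ s' * x s'))"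
  shows "x s = 1 / (1 - \<gamma>) * (\<Sum>s'\<in>UNIV. occupancy_from \<gamma> P \<pi> s s' * g s')"
proof -
  define y where "y s = 1 / (1 - \<gamma>) * (\<Sum>s'\<in>UNIV. occupancy_from \<gamma> P \<pi> s s' * g s')" for s
  let ?M = "\<lambda>h s. \<Sum>a\<in>UNIV. \<pi> $ s $ a * (\<Sum>s1\<in>UNIV. P $ s $ a $ s1 * h s1)"
  have y: "y s = g s + \<gamma> * ?M y s" for s
  proof -
    let ?N = "\<lambda>s'. ?M (\<lambda>s. occupancy_from \<gamma> P \<pi> s s') s"
    have "occupancy_from \<gamma> P \<pi> s s' * g s' =
        (if s = s' then (1 - \<gamma>) * g s' else 0) + \<gamma> * (?N s' * g s')" for s'
      unfolding occupancy_from_unfold(2)[OF assms(1-4), of s s'] by (simp only: distrib_right) simp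
    then have "(\<Sum>s'\<in>UNIV. occupancy_from \<gamma> P \<pi> s s' * g s') =
        (1 - \<gamma>) * g s + \<gamma> * (\<Sum>s'\<in>UNIV. ?N s' * g s')"
      by (simp only: sum.distrib flip: sum_distrib_left) simp
    also have "(\<Sum>s'\<in>UNIV. ?M (\<lambda>s. occupancy_from \<gamma> P \<pi> s s') s * g s') =
        ?M (\<lambda>s. \<Sum>s'\<in>UNIV. occupancy_from \<gamma> P \<pi> s s' * g s') s"
      by (simp add: sum_distrib_left sum_distrib_right mult.assoc)
        (subst sum.swap, rule sum.cong[OF refl], rule sum.swap)
    also have "\<dots> = ?M (\<lambda>s. (1 - \<gamma>) * y s) s"
      using assms(2) by (simp add: y_def)
    also have "\<dots> = (1 - \<gamma>) * ?M y s"
      by (simp add: sum_distrib_left mult_ac)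
    finally show ?thesis
      using assms(2) by (simp add: y_def field_simps)
  qed
  \<comment> \<open>The source \<open>g\<close> cancels, so both differences are subharmonic, and
    both are nonpositive.\<close>
  have "x s - y s = \<gamma> * ?M (\<lambda>s. x s - y s) s" "y s - x s = \<gamma> * ?M (\<lambda>s. y s - x s) s" for s
    using x[of s] y[of s] by (simp_all add: right_diff_distrib sum_subtractf)
  then have "x s - y s \<le> 0" "y s - x s \<le> 0"
    by (intro discounted_subharmonic_nonpos[OF assms(1-4)] eq_refl; blast)+
  then show ?thesis
    by (simp add: y_def)
qed

subsection \<open>Performance difference\<close>

text \<open>Inserting the operator of \<pi>' applied to the value of \<pi> splits the difference
  into a discounted average of itself under \<pi>' and a one-step term with the Q-function of \<pi>.
  This is a Poisson equation for \<pi>', hence the occupancy of \<pi>'.\<close>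

lemma performance_difference:
  fixes P :: "real ^ 's::finite ^ 'a::finite ^ 's"
  assumes "0 < \<gamma>" "\<gamma> < 1" "P \<in> kernels" "\<pi> \<in> policies" "\<pi>' \<in> policies"
  shows "value_fn c \<gamma> P \<pi>' s - value_fn c \<gamma> P \<pi> s =
    1 / (1 - \<gamma>) * (\<Sum>s'\<in>UNIV. occupancy_from \<gamma> P \<pi>' s s' *
      (\<Sum>a\<in>UNIV. (\<pi>' - \<pi>) $ s' $ a * q_fn c \<gamma> P \<pi> s' a))"
proof (rule discounted_poisson_solution[OF assms(1-3,5)])
  fix s
  let ?V = "value_fn c \<gamma> P \<pi>" and ?V' = "value_fn c \<gamma> P \<pi>'"
  have "?V' s - ?V s = (bellman_op c \<gamma> P \<pi>' ?V' s - bellman_op c \<gamma> P \<pi>' ?V s) +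
      (bellman_op c \<gamma> P \<pi>' ?V s - bellman_op c \<gamma> P \<pi> ?V s)"
    by (simp add: value_fn_bellman assms)
  also have "bellman_op c \<gamma> P \<pi>' ?V s - bellman_op c \<gamma> P \<pi> ?V s =
      (\<Sum>a\<in>UNIV. (\<pi>' - \<pi>) $ s $ a * q_fn c \<gamma> P \<pi> s a)"
    unfolding bellman_op_def q_fn_unfold[OF assms(1-4)]
    by (simp add: left_diff_distrib flip: sum_subtractf)
  finally show "?V' s - ?V s = (\<Sum>a\<in>UNIV. (\<pi>' - \<pi>) $ s $ a * q_fn c \<gamma> P \<pi> s a) +
      \<gamma> * (\<Sum>a\<in>UNIV. \<pi>' $ s $ a * (\<Sum>s'\<in>UNIV. P $ s $ a $ s' * (?V' s' - ?V s')))"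
    unfolding bellman_op_diff by simp
qed

text \<open>The occupancy belongs to the new policy \<pi>' and the Q-function to the base policy
  \<pi>. This mixture makes the increment formula exact, and at \<pi>' = \<pi> it is the claimed
  policy gradient.\<close>

definition secant_gradient ::
    "('s \<Rightarrow> 'a \<Rightarrow> real) \<Rightarrow> real \<Rightarrow> 's pmf \<Rightarrow> real ^ 's ^ 'a ^ 's \<Rightarrow> real ^ 'a ^ 's \<Rightarrow> real ^ 'a ^ 's \<Rightarrow>
      real ^ 'a ^ 's" where
  "secant_gradient c \<gamma> \<rho> P \<pi> \<pi>' =
     (\<chi> s. \<chi> a. 1 / (1 - \<gamma>) * occupancy \<gamma> P \<pi>' \<rho> s * q_fn c \<gamma> P \<pi> s a)"

lemma expectation_value_fn_diff:
  fixes P :: "real ^ 's::finite ^ 'a::finite ^ 's"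
  assumes "0 < \<gamma>" "\<gamma> < 1" "P \<in> kernels" "\<pi> \<in> policies" "\<pi>' \<in> policies"
  shows "measure_pmf.expectation \<rho> (value_fn c \<gamma> P \<pi>') - measure_pmf.expectation \<rho> (value_fn c \<gamma> P \<pi>) =
    secant_gradient c \<gamma> \<rho> P \<pi> \<pi>' \<bullet> (\<pi>' - \<pi>)"
proof -
  let ?A = "\<lambda>s'. \<Sum>a\<in>UNIV. (\<pi>' - \<pi>) $ s' $ a * q_fn c \<gamma> P \<pi> s' a"
  have "measure_pmf.expectation \<rho> (value_fn c \<gamma> P \<pi>') - measure_pmf.expectation \<rho> (value_fn c \<gamma> P \<pi>) =
      (\<Sum>s\<in>UNIV. pmf \<rho> s * (value_fn c \<gamma> P \<pi>' s - value_fn c \<gamma> P \<pi> s))"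
    by (simp add: expectation_sum_UNIV right_diff_distrib sum_subtractf)
  also have "\<dots> = 1 / (1 - \<gamma>) * (\<Sum>s\<in>UNIV. \<Sum>s'\<in>UNIV. pmf \<rho> s * occupancy_from \<gamma> P \<pi>' s s' * ?A s')"
    unfolding performance_difference[OF assms] by (simp only: sum_distrib_left mult_ac)
  also have "\<dots> = 1 / (1 - \<gamma>) * (\<Sum>s'\<in>UNIV. occupancy \<gamma> P \<pi>' \<rho> s' * ?A s')"
    by (subst sum.swap) (simp only: occupancy_def expectation_sum_UNIV sum_distrib_right)
  also have "\<dots> = secant_gradient c \<gamma> \<rho> P \<pi> \<pi>' \<bullet> (\<pi>' - \<pi>)"
    unfolding secant_gradient_def inner_vec_def
    by (simp only: vec_lambda_beta inner_real_def sum_distrib_left mult_ac)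
  finally show ?thesis .
qed

section \<open>Continuity in kernel and policy, interior policies, and stability of
  maximizers\<close>

lemma continuous_on_q_fn:
  fixes P :: "'b::topological_space \<Rightarrow> real ^ 's::finite ^ 'a::finite ^ 's"
  assumes "0 < \<gamma>" "\<gamma> < 1"
    and "continuous_on X P" "\<And>z. z \<in> X \<Longrightarrow> P z \<in> kernels"
    and "continuous_on X \<pi>" "\<And>z. z \<in> X \<Longrightarrow> \<pi> z \<in> policies"
  shows "continuous_on X (\<lambda>z. q_fn c \<gamma> (P z) (\<pi> z) s a)"
proof (rule continuous_on_eq)
  show "continuous_on X (\<lambda>z. resolvent \<gamma> (P z) (\<pi> z) (\<lambda>x. c (fst x) (snd x)) (s, a))"
    by (intro continuous_on_resolvent assms)
qed (simp only: q_fn_eq_resolvent[OF assms(1,2,4,6)])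

lemma continuous_on_value_fn:
  fixes P :: "'b::topological_space \<Rightarrow> real ^ 's::finite ^ 'a::finite ^ 's"
  assumes "0 < \<gamma>" "\<gamma> < 1"
    and "continuous_on X P" "\<And>z. z \<in> X \<Longrightarrow> P z \<in> kernels"
    and "continuous_on X \<pi>" "\<And>z. z \<in> X \<Longrightarrow> \<pi> z \<in> policies"
  shows "continuous_on X (\<lambda>z. value_fn c \<gamma> (P z) (\<pi> z) s)"
proof -
  have "continuous_on X (\<lambda>z. \<Sum>a\<in>UNIV. \<pi> z $ s $ a * q_fn c \<gamma> (P z) (\<pi> z) s a)"
    by (intro continuous_intros continuous_on_q_fn assms)
  then show ?thesis
    by (rule continuous_on_eq) (simp add: value_fn_eq_sum_q_fn assms)
qed

lemma continuous_on_occupancy: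
  fixes P :: "'b::topological_space \<Rightarrow> real ^ 's::finite ^ 'a::finite ^ 's"
  assumes "0 < \<gamma>" "\<gamma> < 1"
    and "continuous_on X P" "\<And>z. z \<in> X \<Longrightarrow> P z \<in> kernels"
    and "continuous_on X \<pi>" "\<And>z. z \<in> X \<Longrightarrow> \<pi> z \<in> policies"
  shows "continuous_on X (\<lambda>z. occupancy \<gamma> (P z) (\<pi> z) \<rho> s')"
proof -
  have "continuous_on X (\<lambda>z. occupancy_from \<gamma> (P z) (\<pi> z) s s')" for s
  proof (rule continuous_on_eq)
    show "continuous_on X (\<lambda>z. (1 - \<gamma>) *
        (\<Sum>a\<in>UNIV. \<pi> z $ s $ a * resolvent \<gamma> (P z) (\<pi> z) (\<lambda>x. of_bool (fst x = s')) (s, a)))"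
      by (intro continuous_intros continuous_on_resolvent assms)
  qed (simp only: occupancy_from_unfold(1)[OF assms(1,2,4,6)])
  then show ?thesis
    unfolding occupancy_def expectation_sum_UNIV by (intro continuous_intros)
qed

text \<open>Joint continuity is what the limit requires: the worst kernel moves along with \<pi>',
  while the base policy \<pi> stays fixed.\<close>

lemma continuous_on_secant_gradient:
  fixes P :: "'b::topological_space \<Rightarrow> real ^ 's::finite ^ 'a::finite ^ 's"
  assumes "0 < \<gamma>" "\<gamma> < 1"
    and "continuous_on X P" "\<And>z. z \<in> X \<Longrightarrow> P z \<in> kernels"
    and "continuous_on X \<pi>'" "\<And>z. z \<in> X \<Longrightarrow> \<pi>' z \<in> policies"
    and "\<pi> \<in> policies"
  shows "continuous_on X (\<lambda>z. secant_gradient c \<gamma> \<rho> (P z) \<pi> (\<pi>' z))"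
  unfolding secant_gradient_def
  by (intro continuous_intros continuous_on_occupancy continuous_on_q_fn assms)

text \<open>From a relative interior point one can move slightly further away from any policy.
  Moving away from the policy that always plays \<open>a\<close> lowers the probability of
  \<open>a\<close>, which must therefore have been positive.\<close>

lemma rel_interior_policies_pos:
  fixes \<pi> :: "real ^ 'a::finite ^ 's::finite"
  assumes "\<pi> \<in> rel_interior policies"
  shows "0 < \<pi> $ s $ a"
proof -
  define d :: "real ^ 'a ^ 's" where "d = (\<chi> s. axis a 1)"
  have d: "d \<in> policies"
    by (auto simp: d_def policies_def prob_simplex_def axis_def)
  have "convex (policies :: (real ^ 'a ^ 's) set)"
    unfolding convex_def policies_def prob_simplex_def
    by (auto simp: sum.distrib simp flip: sum_distrib_left)
  then obtain e where e: "e > 1" "(1 - e) *\<^sub>R d + e *\<^sub>R \<pi> \<in> policies"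
    using convex_rel_interior_iff[of policies \<pi>] d assms by blast
  then have "0 \<le> (1 - e) * d $ s $ a + e * \<pi> $ s $ a"
    by (simp add: policies_def prob_simplex_def)
  then have "0 < e * \<pi> $ s $ a"
    using e(1) by (simp add: d_def)
  then show ?thesis
    using e(1) by (simp add: zero_less_mult_iff)
qed

text \<open>If maximizers stayed away from \<open>u0\<close> along a sequence tending to
  \<open>x0\<close>, compactness would give them a limit point. Continuity makes it a maximizer at
  \<open>x0\<close>, so uniqueness identifies it with \<open>u0\<close>, a contradiction. The
  selection \<open>m\<close> is arbitrary.\<close>

lemma tendsto_unique_maximizer:
  fixes F :: "'b::metric_space \<Rightarrow> 'c::metric_space \<Rightarrow> real"
  assumes "compact U" "continuous_on (S \<times> U) (\<lambda>z. F (fst z) (snd z))" "x0 \<in> S" "u0 \<in> U"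
    and unique: "\<And>u. u \<in> U \<Longrightarrow> F x0 u0 \<le> F x0 u \<Longrightarrow> u = u0"
    and m: "\<And>x. x \<in> S \<Longrightarrow> m x \<in> U" "\<And>x u. x \<in> S \<Longrightarrow> u \<in> U \<Longrightarrow> F x u \<le> F x (m x)"
  shows "(m \<longlongrightarrow> u0) (at x0 within S)"
proof (rule tendstoI, rule ccontr)
  fix e :: real
  assume "0 < e" and "\<not> (\<forall>\<^sub>F x in at x0 within S. dist (m x) u0 < e)"
  then have "\<exists>x\<in>S. dist x x0 < inverse (Suc n) \<and> e \<le> dist (m x) u0" for n
    unfolding eventually_at by (metis inverse_positive_iff_positive not_less of_nat_0_less_iff zero_less_Suc)
  then obtain X where X: "\<And>n. X n \<in> S" "\<And>n. dist (X n) x0 < inverse (Suc n)"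
      "\<And>n. e \<le> dist (m (X n)) u0"
    by metis
  have "X \<longlonglongrightarrow> x0"
  proof (rule iffD2[OF tendsto_dist_iff], rule Lim_null_comparison[OF _ LIMSEQ_inverse_real_of_nat], intro always_eventually allI)
    show "norm (dist (X n) x0) \<le> inverse (real (Suc n))" for n
      using less_imp_le[OF X(2)[of n]] by (simp only: real_norm_def abs_of_nonneg[OF zero_le_dist])
  qed
  obtain l r where l: "l \<in> U" "strict_mono r" "(m \<circ> X \<circ> r) \<longlonglongrightarrow> l"
    using \<open>compact U\<close> m(1) X(1) unfolding compact_def by (metis comp_apply)
  have Xr: "(\<lambda>n. X (r n)) \<longlonglongrightarrow> x0"
    using LIMSEQ_subseq_LIMSEQ[OF \<open>X \<longlonglongrightarrow> x0\<close> l(2)] by (simp add: comp_def)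
  \<comment> \<open>Applied to the two sides of the comparison: the fixed competitor
    \<open>u0\<close> and the maximizers along the subsequence.\<close>
  have lim: "(\<lambda>n. F (X (r n)) (v n)) \<longlonglongrightarrow> F x0 u" if "\<And>n. v n \<in> U" "v \<longlonglongrightarrow> u" "u \<in> U" for v u
    using continuous_on_tendsto_compose[OF assms(2) tendsto_Pair[OF Xr that(2)]] that X(1) \<open>x0 \<in> S\<close>
    by (simp add: always_eventually)
  have "F x0 u0 \<le> F x0 l"
  proof (rule LIMSEQ_le[OF lim lim])
    show "(\<lambda>n. m (X (r n))) \<longlonglongrightarrow> l"
      using l(3) by (simp add: comp_def)
  qed (use assms(4) l(1) m X(1) in auto)
  then have "l = u0"
    using unique l(1) by blast
  then have "(\<lambda>n. dist (m (X (r n))) u0) \<longlonglongrightarrow> 0"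
    using l(3) tendsto_dist_iff[of "\<lambda>n. m (X (r n))" u0] by (simp add: comp_def)
  then have "e \<le> 0"
    by (rule LIMSEQ_le_const) (use X(3) in auto)
  then show False
    using \<open>0 < e\<close> by simp
qed

subsection \<open>Robust values\<close>

lemma worst_case_set_iff:
  "w \<in> worst_case_set c \<gamma> P\<^sub>N U \<pi> s a \<longleftrightarrow> w \<in> local_uncertainty U s a \<and>
    (\<forall>v\<in>local_uncertainty U s a.
      (\<Sum>s'\<in>UNIV. (P\<^sub>N $ s $ a + v) $ s' * robust_value c \<gamma> P\<^sub>N U \<pi> s') \<le>
      (\<Sum>s'\<in>UNIV. (P\<^sub>N $ s $ a + w) $ s' * robust_value c \<gamma> P\<^sub>N U \<pi> s'))"
  unfolding worst_case_set_def by (auto simp: is_arg_max_linorder)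

text \<open>
  A maximizer of the sum of the values over all states cannot be improved at any state by the greedy
  kernel, so it already solves the robust Bellman equation.
\<close>

lemma ex_simultaneous_worst_case:
  fixes P\<^sub>N :: "real ^ 's::finite ^ 'a::finite ^ 's"
  assumes "0 < \<gamma>" "\<gamma> < 1" "\<pi> \<in> policies"
    and U: "U \<noteq> {}" "compact U" "sa_rectangular U" "\<And>u. u \<in> U \<Longrightarrow> P\<^sub>N + u \<in> kernels"
  obtains w where "w \<in> U" "\<And>s. value_fn c \<gamma> (P\<^sub>N + w) \<pi> s = robust_value c \<gamma> P\<^sub>N U \<pi> s"
    "\<And>u s. u \<in> U \<Longrightarrow> value_fn c \<gamma> (P\<^sub>N + u) \<pi> s \<le> robust_value c \<gamma> P\<^sub>N U \<pi> s"
    "\<And>s a. w $ s $ a \<in> worst_case_set c \<gamma> P\<^sub>N U \<pi> s a"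
proof -
  have "continuous_on U (\<lambda>u. value_fn c \<gamma> (P\<^sub>N + u) \<pi> s)" for s
    by (intro continuous_on_value_fn continuous_intros assms)
  then have "continuous_on U (\<lambda>u. \<Sum>s\<in>UNIV. value_fn c \<gamma> (P\<^sub>N + u) \<pi> s)"
    by (intro continuous_intros)
  from continuous_attains_sup[OF U(2,1) this] obtain u0 where u0: "u0 \<in> U"
    "\<And>u. u \<in> U \<Longrightarrow> (\<Sum>s\<in>UNIV. value_fn c \<gamma> (P\<^sub>N + u) \<pi> s) \<le> (\<Sum>s\<in>UNIV. value_fn c \<gamma> (P\<^sub>N + u0) \<pi> s)"
    by blast
  define h where "h = value_fn c \<gamma> (P\<^sub>N + u0) \<pi>"
  let ?e = "\<lambda>s a w. \<Sum>s'\<in>UNIV. (P\<^sub>N $ s $ a + w) $ s' * h s'"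
  have "\<exists>w\<in>local_uncertainty U s a. \<forall>v\<in>local_uncertainty U s a. ?e s a v \<le> ?e s a w" for s a
  proof (rule continuous_attains_sup)
    show "compact (local_uncertainty U s a)"
      unfolding local_uncertainty_def
      by (intro compact_continuous_image U(2) continuous_intros)
  qed (use U(1) in \<open>auto simp: local_uncertainty_def intro!: continuous_intros\<close>)
  then have ex: "\<exists>w. w \<in> local_uncertainty U s a \<and> (\<forall>v\<in>local_uncertainty U s a. ?e s a v \<le> ?e s a w)" for s a
    by blast
  define W where
    "W s a = (SOME w. w \<in> local_uncertainty U s a \<and> (\<forall>v\<in>local_uncertainty U s a. ?e s a v \<le> ?e s a w))" for s a
  have W: "W s a \<in> local_uncertainty U s a"
    "v \<in> local_uncertainty U s a \<Longrightarrow> ?e s a v \<le> ?e s a (W s a)" for s a v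
    using someI_ex[OF ex[of s a], folded W_def] by blast+
  define w where "w = (\<chi> s. \<chi> a. W s a)"
  \<comment> \<open>Rectangularity assembles the maximizers, chosen separately for each state-action
    pair, into one element of \<open>U\<close>.\<close>
  have "w \<in> U"
    using U(3) W(1) unfolding sa_rectangular_def w_def by auto
  have greedy: "bellman_op c \<gamma> (P\<^sub>N + u) \<pi> h s \<le> bellman_op c \<gamma> (P\<^sub>N + w) \<pi> h s" if "u \<in> U" for u s
  proof -
    have "?e s a (u $ s $ a) \<le> ?e s a (w $ s $ a)" for a
      using W(2)[of "u $ s $ a" s a] that by (simp add: w_def local_uncertainty_def)
    then have "\<pi> $ s $ a * (c s a + \<gamma> * ?e s a (u $ s $ a)) \<le> \<pi> $ s $ a * (c s a + \<gamma> * ?e s a (w $ s $ a))" for a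
      using assms(1,3) by (intro mult_left_mono add_left_mono) (auto simp: policies_def prob_simplex_def)
    then show ?thesis
      unfolding bellman_op_def by (simp add: sum_mono)
  qed
  note bellman = value_fn_bellman[OF assms(1,2) U(4) assms(3)]
  \<comment> \<open>\<open>h\<close> is the fixed point for \<open>u0\<close>, and the greedy
    operator dominates that of \<open>u0\<close>, so \<open>h\<close> is a subsolution for
    \<open>w\<close>.\<close>
  have le: "h s \<le> value_fn c \<gamma> (P\<^sub>N + w) \<pi> s" for s
    by (rule le_value_fn[OF assms(1,2) U(4)[OF \<open>w \<in> U\<close>] assms(3)])
      (metis greedy[OF u0(1)] bellman[OF u0(1)] h_def)
  \<comment> \<open>Maximality of \<open>u0\<close> for the sum excludes a strict gain in any single
    state.\<close>
  have "(\<Sum>s\<in>UNIV. h s) = (\<Sum>s\<in>UNIV. value_fn c \<gamma> (P\<^sub>N + w) \<pi> s)"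
    using u0(2)[OF \<open>w \<in> U\<close>] le by (intro antisym) (auto simp: h_def intro: sum_mono)
  from sum_mono_inv[OF this le] have h: "value_fn c \<gamma> (P\<^sub>N + w) \<pi> s = h s" for s
    by simp
  then have "value_fn c \<gamma> (P\<^sub>N + w) \<pi> = h"
    by blast
  then have fixpoint: "bellman_op c \<gamma> (P\<^sub>N + w) \<pi> h s = h s" for s
    using bellman[OF \<open>w \<in> U\<close>, of c s] by simp
  \<comment> \<open>Having become the fixed point of the greedy operator, \<open>h\<close> is a
    supersolution for every \<open>u\<close> in \<open>U\<close>.\<close>
  have max: "value_fn c \<gamma> (P\<^sub>N + u) \<pi> s \<le> h s" if "u \<in> U" for u s
    by (rule value_fn_le[OF assms(1,2) U(4)[OF that] assms(3)]) (metis greedy[OF that] fixpoint)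
  have robust: "robust_value c \<gamma> P\<^sub>N U \<pi> s = h s" for s
    unfolding robust_value_def using max u0(1) by (intro cSup_eq_maximum) (auto simp: h_def)
  show thesis
  proof
    show "w $ s $ a \<in> worst_case_set c \<gamma> P\<^sub>N U \<pi> s a" for s a
      unfolding worst_case_set_iff robust using W by (auto simp: w_def)
  qed (use \<open>w \<in> U\<close> h max robust in auto)
qed

text \<open>Compared with a simultaneous worst case \<open>w\<close>, the uncertainty
  \<open>u\<close> is no better at any pair, yet both have the same policy average since they share
  the same value. Positive action probabilities then force equality at every pair.\<close>

lemma worst_case_set_of_optimal:
  fixes P\<^sub>N :: "real ^ 's::finite ^ 'a::finite ^ 's"
  assumes "0 < \<gamma>" "\<gamma> < 1" "\<pi> \<in> policies" "\<And>s a. 0 < \<pi> $ s $ a"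
    and U: "U \<noteq> {}" "compact U" "sa_rectangular U" "\<And>u. u \<in> U \<Longrightarrow> P\<^sub>N + u \<in> kernels"
    and u: "u \<in> U" "\<And>s. value_fn c \<gamma> (P\<^sub>N + u) \<pi> s = robust_value c \<gamma> P\<^sub>N U \<pi> s"
  shows "u $ s $ a \<in> worst_case_set c \<gamma> P\<^sub>N U \<pi> s a"
proof -
  obtain w where w: "w \<in> U" "\<And>s. value_fn c \<gamma> (P\<^sub>N + w) \<pi> s = robust_value c \<gamma> P\<^sub>N U \<pi> s"
    "\<And>s a. w $ s $ a \<in> worst_case_set c \<gamma> P\<^sub>N U \<pi> s a"
    by (rule ex_simultaneous_worst_case[OF assms(1-3) U, where c = c]) blast+
  let ?V = "robust_value c \<gamma> P\<^sub>N U \<pi>"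
  let ?q = "\<lambda>v a. c s a + \<gamma> * (\<Sum>s'\<in>UNIV. (P\<^sub>N $ s $ a + v $ s $ a) $ s' * ?V s')"
  have eq: "(\<Sum>a\<in>UNIV. \<pi> $ s $ a * ?q u a) = (\<Sum>a\<in>UNIV. \<pi> $ s $ a * ?q w a)"
    using value_fn_bellman[OF assms(1,2) U(4)[OF u(1)] assms(3), of c s]
      value_fn_bellman[OF assms(1,2) U(4)[OF w(1)] assms(3), of c s]
    by (simp add: bellman_op_def u(2) w(2))
  have le: "?q u a \<le> ?q w a" for a
    using w(3)[of s a] u(1) assms(1) unfolding worst_case_set_iff
    by (auto simp: local_uncertainty_def intro!: mult_left_mono)
  have "\<pi> $ s $ a * ?q u a = \<pi> $ s $ a * ?q w a"
    by (rule sum_mono_inv[OF eq]) (use le assms(4) in \<open>auto intro!: mult_left_mono less_imp_le\<close>)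
  then have "?q u a = ?q w a"
    using assms(4)[of s a] by simp
  then show ?thesis
    using w(3)[of s a] u(1) assms(1) unfolding worst_case_set_iff by (auto simp: local_uncertainty_def)
qed

section \<open>Differentiability of the robust value in the relative interior\<close>

theorem lemma2p5:
  fixes c :: "'s::finite \<Rightarrow> 'a::finite \<Rightarrow> real"
    and \<gamma> :: real
    and P\<^sub>N :: "real ^ 's ^ 'a ^ 's"
    and U :: "(real ^ 's ^ 'a ^ 's) set"
    and \<rho> :: "'s pmf"
  assumes cost: "\<And>s a. 0 < c s a \<and> c s a \<le> 1"
    and discount: "0 < \<gamma>" "\<gamma> < 1"
    and nominal: "P\<^sub>N \<in> kernels"
    and uncertainty: "U \<noteq> {}" "compact U" "sa_rectangular U"
    and kernel: "\<And>u. u \<in> U \<Longrightarrow> P\<^sub>N + u \<in> kernels"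
    and unique_worst_case:
      "\<And>\<pi> s a. \<pi> \<in> rel_interior policies \<Longrightarrow> is_singleton (worst_case_set c \<gamma> P\<^sub>N U \<pi> s a)"
  shows "\<forall>\<pi>\<in>rel_interior policies.
    has_policy_gradient
      (\<lambda>\<pi>. measure_pmf.expectation \<rho> (robust_value c \<gamma> P\<^sub>N U \<pi>))
      (\<chi> s. \<chi> a. 1 / (1 - \<gamma>)
                * occupancy \<gamma> (P\<^sub>N + worst_case c \<gamma> P\<^sub>N U \<pi>) \<pi> \<rho> s
                * q_fn c \<gamma> (P\<^sub>N + worst_case c \<gamma> P\<^sub>N U \<pi>) \<pi> s a)
      \<pi>"
proof
  fix \<pi> :: "real ^ 'a ^ 's"
  assume ri: "\<pi> \<in> rel_interior policies"
  then have \<pi>: "\<pi> \<in> policies"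
    using rel_interior_subset by blast
  note U = uncertainty kernel
  define V where "V = robust_value c \<gamma> P\<^sub>N U"
  define u0 where "u0 = worst_case c \<gamma> P\<^sub>N U \<pi>"
  define f where "f \<pi> = measure_pmf.expectation \<rho> (V \<pi>)" for \<pi>
  define G where "G u = secant_gradient c \<gamma> \<rho> (P\<^sub>N + u) \<pi>" for u

  have "\<exists>w. w \<in> U \<and> (\<forall>s. value_fn c \<gamma> (P\<^sub>N + w) \<pi>' s = V \<pi>' s) \<and>
      (\<forall>u\<in>U. \<forall>s. value_fn c \<gamma> (P\<^sub>N + u) \<pi>' s \<le> V \<pi>' s)" if "\<pi>' \<in> policies" for \<pi>'
    unfolding V_def by (rule ex_simultaneous_worst_case[OF discount that U, where c = c]) blast+
  \<comment> \<open>A mere choice of an optimal uncertainty for each policy; its convergence at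
    \<pi> comes from uniqueness at \<pi> alone.\<close>
  then obtain m where m: "\<And>\<pi>'. \<pi>' \<in> policies \<Longrightarrow> m \<pi>' \<in> U"
    "\<And>\<pi>' s. \<pi>' \<in> policies \<Longrightarrow> value_fn c \<gamma> (P\<^sub>N + m \<pi>') \<pi>' s = V \<pi>' s"
    "\<And>\<pi>' u s. \<pi>' \<in> policies \<Longrightarrow> u \<in> U \<Longrightarrow> value_fn c \<gamma> (P\<^sub>N + u) \<pi>' s \<le> V \<pi>' s"
    by metis
  \<comment> \<open>Uniqueness is assumed for one-step maximizers; positivity of \<pi> transfers it
    to uncertainties attaining the robust value.\<close>
  have optimal_eq: "u = u0" if "u \<in> U" "\<And>s. value_fn c \<gamma> (P\<^sub>N + u) \<pi> s = V \<pi> s" for u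
  proof -
    have "u $ s $ a \<in> worst_case_set c \<gamma> P\<^sub>N U \<pi> s a" for s a
      using worst_case_set_of_optimal[OF discount \<pi> rel_interior_policies_pos[OF ri] U that(1)] that(2)
      by (simp add: V_def)
    then have "the_elem (worst_case_set c \<gamma> P\<^sub>N U \<pi> s a) = u $ s $ a" for s a
      using unique_worst_case[OF ri, of s a] by (metis is_singleton_the_elem singletonD)
    then show ?thesis
      by (simp add: u0_def worst_case_def vec_eq_iff)
  qed
  have u0: "u0 \<in> U" "\<And>s. value_fn c \<gamma> (P\<^sub>N + u0) \<pi> s = V \<pi> s"
    using optimal_eq[OF m(1,2)[OF \<pi>]] m(1,2)[OF \<pi>] by auto

  have m_lim: "(m \<longlongrightarrow> u0) (at \<pi> within policies)"
  proof (rule tendsto_unique_maximizer[OF \<open>compact U\<close>])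
    \<comment> \<open>The unweighted sum is used instead of the \<rho>-average: \<rho> may vanish at
      some states, whereas equality of the sums forces equality in every state.\<close>
    let ?F = "\<lambda>\<pi>' u. \<Sum>s\<in>UNIV. value_fn c \<gamma> (P\<^sub>N + u) \<pi>' s"
    have "continuous_on (policies \<times> U) (\<lambda>z. value_fn c \<gamma> (P\<^sub>N + snd z) (fst z) s)" for s
      by (intro continuous_on_value_fn continuous_intros discount kernel) auto
    then show "continuous_on (policies \<times> U) (\<lambda>z. ?F (fst z) (snd z))"
      by (intro continuous_intros)
    show "u = u0" if "u \<in> U" "?F \<pi> u0 \<le> ?F \<pi> u" for u
    proof (rule optimal_eq[OF that(1)])
      fix s
      have "?F \<pi> u = (\<Sum>s\<in>UNIV. V \<pi> s)"
        using that(2) m(3)[OF \<pi> that(1)] by (intro antisym) (auto simp: u0 intro: sum_mono)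
      from sum_mono_inv[OF this m(3)[OF \<pi> that(1)]] show "value_fn c \<gamma> (P\<^sub>N + u) \<pi> s = V \<pi> s"
        by simp
    qed
  qed (use \<pi> u0 m in \<open>auto intro!: sum_mono\<close>)

  \<comment> \<open>Stated for a general selection \<open>v\<close>, since it is used both for the
    constant \<open>u0\<close> and for \<open>m\<close>.\<close>
  have G_lim: "((\<lambda>\<pi>'. G (v \<pi>') \<pi>') \<longlongrightarrow> G u0 \<pi>) (at \<pi> within policies)"
    if "\<And>\<pi>'. \<pi>' \<in> policies \<Longrightarrow> v \<pi>' \<in> U" "(v \<longlongrightarrow> u0) (at \<pi> within policies)" for v
  proof -
    have "continuous_on (U \<times> policies) (\<lambda>z. G (fst z) (snd z))"
      unfolding G_def
      by (intro continuous_on_secant_gradient continuous_intros discount kernel \<pi>) auto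
    from continuous_on_tendsto_compose[OF this tendsto_Pair[OF that(2) tendsto_ident_at]]
    show ?thesis
      using u0(1) \<pi> that(1) by (simp add: eventually_at_filter)
  qed
  \<comment> \<open>The errors of the lower and upper secant gradients, added so that one bound
    covers both signs.\<close>
  define e where "e \<pi>' = norm (G u0 \<pi>' - G u0 \<pi>) + norm (G (m \<pi>') \<pi>' - G u0 \<pi>)" for \<pi>'
  have "(e \<longlongrightarrow> norm (G u0 \<pi> - G u0 \<pi>) + norm (G u0 \<pi> - G u0 \<pi>)) (at \<pi> within policies)"
    unfolding e_def by (intro tendsto_intros G_lim m_lim m(1) u0(1))
  then have e_lim: "(e \<longlongrightarrow> 0) (at \<pi> within policies)"
    by simp

  have bound: "\<bar>f \<pi>' - f \<pi> - G u0 \<pi> \<bullet> (\<pi>' - \<pi>)\<bar> / norm (\<pi>' - \<pi>) \<le> e \<pi>'" if \<pi>': "\<pi>' \<in> policies" for \<pi>'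
  proof -
    have expect: "measure_pmf.expectation \<rho> (value_fn c \<gamma> (P\<^sub>N + u) \<pi>'') \<le> f \<pi>''"
      if "u \<in> U" "\<pi>'' \<in> policies" for u \<pi>''
      unfolding f_def expectation_sum_UNIV using m(3)[OF that(2,1)] by (intro sum_mono mult_left_mono) auto
    have diff: "measure_pmf.expectation \<rho> (value_fn c \<gamma> (P\<^sub>N + u) \<pi>') -
        measure_pmf.expectation \<rho> (value_fn c \<gamma> (P\<^sub>N + u) \<pi>) = G u \<pi>' \<bullet> (\<pi>' - \<pi>)" if "u \<in> U" for u
      unfolding G_def by (rule expectation_value_fn_diff[OF discount kernel[OF that] \<pi> \<pi>'])
    have "f \<pi> = measure_pmf.expectation \<rho> (value_fn c \<gamma> (P\<^sub>N + u0) \<pi>)"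
      "f \<pi>' = measure_pmf.expectation \<rho> (value_fn c \<gamma> (P\<^sub>N + m \<pi>') \<pi>')"
      by (simp_all add: f_def u0 m \<pi>' expectation_sum_UNIV)
    \<comment> \<open>At \<pi>' the uncertainty \<open>u0\<close> is merely feasible, which gives
      the lower bound; at \<pi> the uncertainty \<open>m \<pi>'\<close> is merely feasible, which
      gives the upper bound. Both increments are exact by performance difference.\<close>
    then have "G u0 \<pi>' \<bullet> (\<pi>' - \<pi>) \<le> f \<pi>' - f \<pi>" "f \<pi>' - f \<pi> \<le> G (m \<pi>') \<pi>' \<bullet> (\<pi>' - \<pi>)"
      using diff[OF u0(1)] diff[OF m(1)[OF \<pi>']] expect[OF u0(1) \<pi>'] expect[OF m(1)[OF \<pi>'] \<pi>]
      by linarith+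
    then have "\<bar>f \<pi>' - f \<pi> - G u0 \<pi> \<bullet> (\<pi>' - \<pi>)\<bar> \<le>
        \<bar>(G u0 \<pi>' - G u0 \<pi>) \<bullet> (\<pi>' - \<pi>)\<bar> + \<bar>(G (m \<pi>') \<pi>' - G u0 \<pi>) \<bullet> (\<pi>' - \<pi>)\<bar>"
      unfolding inner_diff_left by linarith
    also have "\<dots> \<le> e \<pi>' * norm (\<pi>' - \<pi>)"
      unfolding e_def distrib_right by (intro add_mono Cauchy_Schwarz_ineq2)
    \<comment> \<open>For \<pi>' = \<pi> the quotient is 0 by the convention for division by zero,
      and the error is nonnegative.\<close>
    finally show ?thesis
      by (cases "\<pi>' = \<pi>") (simp_all add: e_def pos_divide_le_eq)
  qed

  have "has_policy_gradient f (G u0 \<pi>) \<pi>"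
    unfolding has_policy_gradient_def
  proof (rule Lim_null_comparison)
    let ?D = "{\<delta>. \<pi> + \<delta> \<in> policies}"
    have "norm (\<bar>f (\<pi> + \<delta>) - f \<pi> - G u0 \<pi> \<bullet> \<delta>\<bar> / norm \<delta>) \<le> e (\<pi> + \<delta>)" if "\<delta> \<in> ?D" for \<delta>
      using bound[of "\<pi> + \<delta>"] that by simp
    then show "\<forall>\<^sub>F \<delta> in at 0 within ?D. norm (\<bar>f (\<pi> + \<delta>) - f \<pi> - G u0 \<pi> \<bullet> \<delta>\<bar> / norm \<delta>) \<le> e (\<pi> + \<delta>)"
      by (simp add: eventually_at_filter)
    \<comment> \<open>Translation by \<pi> carries the punctured neighbourhoods of 0 in the feasible
      increments to those of \<pi> in the policies.\<close>
    have "filterlim (\<lambda>\<delta>. \<pi> + \<delta>) (at \<pi> within policies) (at 0 within ?D)"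
      unfolding filterlim_at
      by (auto simp: eventually_at_filter intro!: tendsto_eq_intros)
    then show "((\<lambda>\<delta>. e (\<pi> + \<delta>)) \<longlongrightarrow> 0) (at 0 within ?D)"
      by (rule filterlim_compose[OF e_lim])
  qed
  then show "has_policy_gradient
      (\<lambda>\<pi>. measure_pmf.expectation \<rho> (robust_value c \<gamma> P\<^sub>N U \<pi>))
      (\<chi> s. \<chi> a. 1 / (1 - \<gamma>)
                * occupancy \<gamma> (P\<^sub>N + worst_case c \<gamma> P\<^sub>N U \<pi>) \<pi> \<rho> s
                * q_fn c \<gamma> (P\<^sub>N + worst_case c \<gamma> P\<^sub>N U \<pi>) \<pi> s a)
      \<pi>"
    unfolding f_def[abs_def] V_def G_def secant_gradient_def u0_def .
qed

end
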